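(* Let $\Omega=\{\omega_1,\dots,\omega_k\}\subseteq\mathbb{R}^n$ and $q\in\mathbb{R}^k$ with all $q_i>0$. For any $0<\delta<2\beta$ and any $\theta\in\operatorname{conv}\Omega$, there exists $x\in W$ such that $$\|x\|_2\le\frac{m}{\varphi}\log\!\left(\frac{2\beta}{\delta}\right)\quad\text{and}\quad F_\theta(x)\le F_\theta^*+\delta,$$ where $m=\dim\operatorname{aff}\Omega\le n$ and $\varphi$ is the facet gap of $\Omega$.
   Context: $\log$ is the natural logarithm. $F_\theta(x)=\log\sum_{i=1}^k q_i e^{\langle \omega_i-\theta,x\rangle}$ for $x\in\mathbb{R}^n$, $F_\theta^*=\inf_{x\in\mathbb{R}^n}F_\theta(x)$, $\beta=\|q\|_1/\min_{i\in[k]}q_i$. $W$ is the linear span of the vectors $\omega_i-\theta$, $i\in[k]$ (equivalently, the direction space of the affine hull $\operatorname{aff}\Omega$). The facet gap $\varphi>0$ of $\Omega$ is the smallest Euclidean distance $d(\omega,\operatorname{aff}\mathcal F)$ over all facets $\mathcal F$ of $\operatorname{conv}\Omega$ and all $\omega\in\Omega\setminus \mathcal F$ (facets are faces of codimension one relative to $\operatorname{aff}\Omega$); $\Omega$ is assumed to contain at least two points so that $\varphi$ is well-defined. *)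

theory Defs
  imports "HOL-Analysis.Analysis"
begin

text \<open>The point set is the range of a family of vectors indexed by a finite type, with weights
  \<^term>\<open>q\<close> indexed alike.  The family may have repetitions.\<close>

definition F_theta :: "(real^'k) \<Rightarrow> ('k \<Rightarrow> real^'n) \<Rightarrow> real^'n \<Rightarrow> real^'n \<Rightarrow> real" where
  "F_theta q \<omega> \<theta> x = ln (\<Sum>i\<in>UNIV. q $ i * exp ((\<omega> i - \<theta>) \<bullet> x))"

text \<open>The infimum below is over a set that is bounded below when all weights are positive and
  \<open>\<theta>\<close> lies in the convex hull of the points; otherwise it need not be meaningful.\<close>

definition F_theta_inf :: "(real^'k) \<Rightarrow> ('k \<Rightarrow> real^'n) \<Rightarrow> real^'n \<Rightarrow> real" where
  "F_theta_inf q \<omega> \<theta> = (INF x. F_theta q \<omega> \<theta> x)"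

definition weight_ratio :: "(real^'k) \<Rightarrow> real" where
  "weight_ratio q = (\<Sum>i\<in>UNIV. \<bar>q $ i\<bar>) / Min (range (($) q))"

definition W_space :: "('k \<Rightarrow> real^'n) \<Rightarrow> real^'n \<Rightarrow> (real^'n) set" where
  "W_space \<omega> \<theta> = span (range (\<lambda>i. \<omega> i - \<theta>))"

definition facet_distances :: "(real^'n) set \<Rightarrow> real set" where
  "facet_distances \<Omega> =
     {infdist w (affine hull F) |F w. F facet_of (convex hull \<Omega>) \<and> w \<in> \<Omega> - F}"

definition facet_gap :: "(real^'n) set \<Rightarrow> real" where
  "facet_gap \<Omega> = Min (facet_distances \<Omega>)"

text \<open>Well-definedness of the facet gap: the set of distances is finite, and it is nonempty once
  there are at least two points, so the minimum is attained.\<close>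

lemma finite_facet_distances:
  assumes "finite \<Omega>"
  shows "finite (facet_distances \<Omega>)"
proof -
  have "finite {F. F facet_of (convex hull \<Omega>)}"
    by (rule finite_polytope_facets) (use assms in \<open>auto simp: polytope_def\<close>)
  then have "finite ((\<lambda>(F, w). infdist w (affine hull F)) ` ({F. F facet_of (convex hull \<Omega>)} \<times> \<Omega>))"
    using assms by blast
  then show ?thesis
    by (rule rev_finite_subset) (force simp: facet_distances_def)
qed

lemma facet_distances_nonempty:
  assumes "finite \<Omega>" "card \<Omega> \<ge> 2"
  shows "facet_distances \<Omega> \<noteq> {}"
proof -
  have ne: "\<Omega> \<noteq> {}" "\<nexists>a. \<Omega> = {a}"
    using assms(2) by auto
  have "aff_dim \<Omega> \<noteq> -1" "aff_dim \<Omega> \<noteq> 0" "aff_dim \<Omega> \<ge> -1"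
    using ne aff_dim_geq[of \<Omega>] by (auto simp: aff_dim_empty aff_dim_eq_0)
  then have "aff_dim (convex hull \<Omega>) > 0"
    by (simp add: aff_dim_convex_hull)
  moreover have "polytope (convex hull \<Omega>)"
    using assms(1) by (auto simp: polytope_def)
  ultimately obtain F where F: "F facet_of (convex hull \<Omega>)"
    using polytope_facet_exists by blast
  have "\<not> \<Omega> \<subseteq> F"
  proof
    assume "\<Omega> \<subseteq> F"
    moreover have "convex F"
      using F facet_of_imp_face_of face_of_imp_convex convex_convex_hull by blast
    ultimately have "convex hull \<Omega> \<subseteq> F"
      by (simp add: hull_minimal)
    then have "F = convex hull \<Omega>"
      using F facet_of_imp_subset by blast
    then show False
      using F by simp
  qed
  then show ?thesis
    using F by (auto simp: facet_distances_def)
qed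

lemma facet_gap_pos:
  assumes "finite \<Omega>" "card \<Omega> \<ge> 2"
  shows "facet_gap \<Omega> > 0"
proof -
  have "d > 0" if d: "d \<in> facet_distances \<Omega>" for d
  proof -
    from d obtain F w where F: "F facet_of (convex hull \<Omega>)" and w: "w \<in> \<Omega>" "w \<notin> F"
      and d_eq: "d = infdist w (affine hull F)"
      by (auto simp: facet_distances_def)
    have "F = affine hull F \<inter> convex hull \<Omega>"
      using F facet_of_imp_face_of face_of_imp_eq_affine_Int convex_convex_hull by blast
    then have "w \<notin> affine hull F"
      using w hull_inc[of w \<Omega> convex] by blast
    moreover have "affine hull F \<noteq> {}"
      using F by (auto simp: facet_of_def)
    ultimately show ?thesis
      unfolding d_eq by (simp add: infdist_pos_not_in_closed)
  qed
  then show ?thesis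
    unfolding facet_gap_def
    using finite_facet_distances[OF assms(1)] facet_distances_nonempty[OF assms]
    by (subst Min_gr_iff) auto
qed

end

theory Submission
  imports Defs
begin

text \<open>Let \<open>x\<close> be a near-minimizer in \<open>W\<close> and \<open>p\<close> a point of \<open>\<Omega>\<close> maximizing \<open>\<langle>x, \<cdot>\<rangle>\<close>.  Then \<open>x\<close> is a
  nonnegative combination of at most \<open>m\<close> unit normals of facets through \<open>p\<close>.  Truncating every
  coefficient at \<open>L = log (2\<beta>/\<delta>) / \<phi>\<close> gives a vector \<open>y\<close> of norm at most \<open>m L\<close>.  If \<open>w \<in> \<Omega>\<close> lies on
  every facet whose coefficient was cut, its exponential term does not increase, because \<open>\<theta>\<close> is on
  the inner side of these facets; otherwise \<open>w\<close> is at distance at least \<open>\<phi>\<close> from such a facet, and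
  its exponential is at most \<open>\<delta>/(2\<beta>)\<close> times that of \<open>p\<close> at \<open>x\<close>.  So the sum of exponentials
  grows at most by a factor \<open>1 + \<delta>/2\<close>.\<close>

section \<open>Unit normals of facets, with \<open>W\<close> as the direction space of the affine
  hull of \<Omega>\<close>

context
  fixes \<Omega> W :: "'a::euclidean_space set"
  assumes fin: "finite \<Omega>"
    and subW: "subspace W"
    and diff_W: "\<And>v w. v \<in> affine hull \<Omega> \<Longrightarrow> w \<in> affine hull \<Omega> \<Longrightarrow> v - w \<in> W"
    and add_W: "\<And>v y. v \<in> affine hull \<Omega> \<Longrightarrow> y \<in> W \<Longrightarrow> v + y \<in> affine hull \<Omega>"
begin

text \<open>A normal of a hyperplane exposing \<open>G\<close> is projected orthogonally to
  \<open>W\<close> and normalized; pairings with differences of points of the affine hull survive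
  the projection. Lying in \<open>W\<close> makes the normal measure the distance to
  \<open>affine hull G\<close> inside the affine hull of \<Omega>.\<close>

lemma facet_unit_normal:
  assumes G: "G facet_of convex hull \<Omega>" and p: "p \<in> G"
  obtains u where "u \<in> W" "norm u = 1"
    "\<And>w. w \<in> convex hull \<Omega> \<Longrightarrow> w \<in> G \<longleftrightarrow> u \<bullet> w = u \<bullet> p"
    "\<And>w. w \<in> convex hull \<Omega> \<Longrightarrow> u \<bullet> w \<le> u \<bullet> p - infdist w (affine hull G)"
proof -
  let ?P = "convex hull \<Omega>" and ?A = "affine hull \<Omega>"
  have PA: "?P \<subseteq> ?A" by (rule convex_hull_subset_affine_hull)
  have GP: "G \<subseteq> ?P" using G by (rule facet_of_imp_subset)
  have "polyhedron ?P"
    using fin by (intro polytope_imp_polyhedron) (auto simp: polytope_def)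
  then have "G exposed_face_of ?P"
    using G facet_of_imp_face_of exposed_face_of_polyhedron by blast
  then obtain a b where ab: "?P \<subseteq> {x. a \<bullet> x \<le> b}" "G = ?P \<inter> {x. a \<bullet> x = b}"
    unfolding exposed_face_of_def by blast
  obtain y z where "y \<in> span W" and orth: "\<And>w. w \<in> span W \<Longrightarrow> orthogonal z w" and a: "a = y + z"
    using orthogonal_subspace_decomp_exists[of W a] by blast
  then have y: "y \<in> W" by (simp add: span_eq_iff[THEN iffD2, OF subW])
  have pA: "p \<in> ?A" using p GP PA by blast
  have ip: "y \<bullet> (w - p) = a \<bullet> (w - p)" if "w \<in> ?A" for w
    using orth[of "w - p"] diff_W[OF that pA]
    by (simp add: a inner_add_left orthogonal_def span_base)
  have ap: "a \<bullet> p = b" using ab p by auto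
  have le: "y \<bullet> w \<le> y \<bullet> p" if "w \<in> ?P" for w
    using ip[OF subsetD[OF PA that]] subsetD[OF ab(1) that] ap by (simp add: inner_diff_right)
  have iff: "w \<in> G \<longleftrightarrow> y \<bullet> w = y \<bullet> p" if "w \<in> ?P" for w
    using ip[of w] that PA ab ap by (auto simp: inner_diff_right)
  obtain v where v: "v \<in> ?P" "v \<notin> G"
    using G GP by (metis facet_of_irrefl subsetI subset_antisym)
  then have "y \<noteq> 0" using iff by auto
  define u where "u = y /\<^sub>R norm y"
  have uW: "u \<in> W" and nu: "norm u = 1"
    using y subW \<open>y \<noteq> 0\<close> by (auto simp: u_def subspace_scale)
  have uy: "u \<bullet> w = (y \<bullet> w) / norm y" for w by (simp add: u_def divide_inverse mult.commute)
  have uiff: "w \<in> G \<longleftrightarrow> u \<bullet> w = u \<bullet> p" if "w \<in> ?P" for w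
    using iff[OF that] \<open>y \<noteq> 0\<close> by (simp add: uy)
  let ?H = "{w. u \<bullet> w = u \<bullet> p}"
  have "affine (?A \<inter> ?H)" by (simp add: affine_Int affine_hyperplane)
  have sub: "affine hull G \<subseteq> ?A \<inter> ?H"
    by (rule hull_minimal) (use GP PA uiff \<open>affine (?A \<inter> ?H)\<close> in auto)
  \<comment> \<open>The point \<open>v\<close> keeps the hyperplane from containing
    \<open>?A\<close>, so the slice has codimension one, just as the facet does; the inclusion is
    then an equality.\<close>
  have "aff_dim (?A \<inter> ?H) = aff_dim ?A - 1"
    using v uiff PA pA by (subst aff_dim_affine_Int_hyperplane) auto
  then have "aff_dim (affine hull G) = aff_dim (?A \<inter> ?H)"
    using G by (simp add: facet_of_def aff_dim_convex_hull)
  then have affG: "affine hull G = ?A \<inter> ?H"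
    using sub p \<open>affine (?A \<inter> ?H)\<close> by (intro affine_dim_equal) auto
  have "infdist w (affine hull G) \<le> u \<bullet> p - u \<bullet> w" if w: "w \<in> ?P" for w
  proof -
    \<comment> \<open>Moving \<open>w\<close> by \<open>?t\<close> along the unit vector
      \<open>u\<close> reaches the hyperplane without leaving \<open>?A\<close>, so
      \<open>?t\<close> bounds the distance.\<close>
    let ?t = "u \<bullet> p - u \<bullet> w"
    have t: "?t \<ge> 0" using le[OF w] by (simp add: uy divide_right_mono)
    have "u \<bullet> u = 1" using nu by (simp add: dot_square_norm)
    then have "w + ?t *\<^sub>R u \<in> affine hull G"
      unfolding affG using w PA uW subW
      by (auto intro!: add_W subspace_scale simp: inner_add_right)
    then have "infdist w (affine hull G) \<le> dist w (w + ?t *\<^sub>R u)" by (rule infdist_le)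
    then show ?thesis using t nu by (simp add: dist_norm)
  qed
  then show thesis
    using that[OF uW nu uiff] by fastforce
qed

section \<open>Decomposing vectors of the normal cone at \<open>p\<close>\<close>

context
  fixes \<phi> :: real and p :: 'a
  assumes gap_pos: "\<phi> > 0"
    and gap: "\<And>F w. F facet_of convex hull \<Omega> \<Longrightarrow> w \<in> \<Omega> - F \<Longrightarrow> \<phi> \<le> infdist w (affine hull F)"
    and p: "p \<in> \<Omega>"
begin

text \<open>Each step subtracts the largest multiple of the normal of a facet containing the face
  exposed by \<open>x\<close> for which \<open>p\<close> stays a maximizer; the exposed face then acquires a point off
  that facet, so its dimension goes up.\<close>

lemma normal_cone_decomposition:
  assumes "x \<in> W" and "\<And>w. w \<in> \<Omega> \<Longrightarrow> x \<bullet> w \<le> x \<bullet> p"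
    and "aff_dim \<Omega> \<le> aff_dim {w \<in> \<Omega>. x \<bullet> w = x \<bullet> p} + int n"
  shows "\<exists>r c u. r \<le> n \<and> x = (\<Sum>j<r. c j *\<^sub>R u j) \<and>
    (\<forall>j<r. c j \<ge> 0 \<and> u j \<in> W \<and> norm (u j) = 1 \<and>
      (\<forall>w\<in>\<Omega>. u j \<bullet> w = u j \<bullet> p \<or> u j \<bullet> w \<le> u j \<bullet> p - \<phi>))"
  using assms
proof (induction n arbitrary: x)
  case 0
  let ?T = "{w \<in> \<Omega>. x \<bullet> w = x \<bullet> p}"
  \<comment> \<open>With no dimension left to gain, \<open>x\<close> is constant on the whole affine
    hull, which contains \<open>p + x\<close>; hence \<open>x \<bullet> x = 0\<close>.\<close>
  have "aff_dim ?T \<le> aff_dim \<Omega>" by (rule aff_dim_subset) auto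
  then have "affine hull ?T = affine hull \<Omega>"
    using 0(3) p by (intro affine_dim_equal hull_mono) auto
  moreover have "affine hull ?T \<subseteq> {w. x \<bullet> w = x \<bullet> p}"
    by (rule hull_minimal) (auto simp: affine_hyperplane)
  moreover have "p + x \<in> affine hull \<Omega>"
    using p 0(1) by (auto intro: add_W hull_inc)
  ultimately have "x \<bullet> (p + x) = x \<bullet> p" by auto
  then have "x = 0" by (simp add: inner_add_right)
  then show ?case by (intro exI[of _ 0]) auto
next
  case (Suc n)
  let ?P = "convex hull \<Omega>" and ?T = "\<lambda>x. {w \<in> \<Omega>. x \<bullet> w = x \<bullet> p}"
  show ?case
  proof (cases "\<Omega> \<subseteq> {w. x \<bullet> w = x \<bullet> p}")
    case True
    \<comment> \<open>The exposed face is already everything, so the dimension hypothesis holds for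
      \<open>n\<close> with the same \<open>x\<close>.\<close>
    then have "?T x = \<Omega>" by auto
    then show ?thesis using Suc.IH[OF Suc.prems(1,2)] by (auto intro: le_SucI)
  next
    case False
    let ?F = "?P \<inter> {w. x \<bullet> w = x \<bullet> p}"
    have "?P \<subseteq> {w. x \<bullet> w \<le> x \<bullet> p}"
      by (rule hull_minimal) (use Suc.prems(2) in \<open>auto simp: convex_halfspace_le\<close>)
    then have "?F face_of ?P"
      by (intro face_of_Int_supporting_hyperplane_le) auto
    moreover have "polyhedron ?P"
      using fin by (intro polytope_imp_polyhedron) (auto simp: polytope_def)
    moreover have "?F \<noteq> {}" "?F \<noteq> ?P"
      using p False by (auto intro: hull_inc)
    ultimately obtain G where G: "G facet_of ?P" "?F \<subseteq> G"
      using face_of_polyhedron_subset_facet by metis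
    have TG: "?T x \<subseteq> G" using G(2) by (auto intro: hull_inc)
    then have "p \<in> G" using p by auto
    then obtain u where u: "u \<in> W" "norm u = 1"
      and uG: "\<And>w. w \<in> ?P \<Longrightarrow> w \<in> G \<longleftrightarrow> u \<bullet> w = u \<bullet> p"
      and udist: "\<And>w. w \<in> ?P \<Longrightarrow> u \<bullet> w \<le> u \<bullet> p - infdist w (affine hull G)"
      using facet_unit_normal[OF G(1)] by metis
    have ugap: "u \<bullet> w \<le> u \<bullet> p - \<phi>" if "w \<in> \<Omega> - G" for w
      using gap[OF G(1) that] udist[of w] that by (auto simp: hull_inc)
    \<comment> \<open>\<open>f w\<close> is the largest multiple of \<open>u\<close> that can be
      subtracted from \<open>x\<close> before \<open>w\<close> overtakes \<open>p\<close>. Points of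
      \<open>G\<close> impose no bound, since \<open>u\<close> is constant there.\<close>
    define f where "f w = (x \<bullet> p - x \<bullet> w) / (u \<bullet> p - u \<bullet> w)" for w
    have ne: "\<Omega> - G \<noteq> {}"
    proof
      assume "\<Omega> - G = {}"
      then have "?P \<subseteq> G"
        using G(1) by (intro hull_minimal)
          (auto dest: facet_of_imp_face_of face_of_imp_convex)
      then show False
        using G(1) facet_of_imp_subset by (metis facet_of_irrefl subset_antisym)
    qed
    define t where "t = Min (f ` (\<Omega> - G))"
    have "t \<in> f ` (\<Omega> - G)" unfolding t_def using fin ne by (intro Min_in) auto
    then obtain v where v: "v \<in> \<Omega> - G" "t = f v" by auto
    have f_nonneg: "f w \<ge> 0" if "w \<in> \<Omega> - G" for w
      unfolding f_def using Suc.prems(2)[of w] ugap[OF that] gap_pos that by auto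
    have t_le: "t * (u \<bullet> p - u \<bullet> w) \<le> x \<bullet> p - x \<bullet> w" if w: "w \<in> \<Omega> - G" for w
    proof -
      have "t \<le> f w" unfolding t_def using fin w by (intro Min_le) auto
      then show ?thesis using ugap[OF w] gap_pos by (simp add: f_def pos_le_divide_eq)
    qed
    define y where "y = x - t *\<^sub>R u"
    have yW: "y \<in> W" using Suc.prems(1) u subW by (simp add: y_def subspace_diff subspace_scale)
    have y_le: "y \<bullet> w \<le> y \<bullet> p" if w: "w \<in> \<Omega>" for w
    proof (cases "w \<in> G")
      case True
      then show ?thesis using uG[of w] Suc.prems(2)[OF w] w by (auto simp: y_def inner_diff_left hull_inc)
    next
      case False
      then show ?thesis using t_le[of w] w by (simp add: y_def inner_diff_left algebra_simps)
    qed
    have "t * (u \<bullet> p - u \<bullet> v) = x \<bullet> p - x \<bullet> v"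
      using v ugap[of v] gap_pos by (simp add: f_def)
    then have vT: "v \<in> ?T y" using v by (auto simp: y_def inner_diff_left algebra_simps)
    have sub: "?T x \<subseteq> ?T y"
      using TG uG by (auto simp: y_def inner_diff_left hull_inc)
    \<comment> \<open>The new maximizer \<open>v\<close> is affinely independent of the old face,
      because \<open>u\<close> is constant on that face and smaller at \<open>v\<close>.\<close>
    have "affine hull (?T x) \<subseteq> {w. u \<bullet> w = u \<bullet> p}"
      by (rule hull_minimal) (use TG uG in \<open>auto simp: affine_hyperplane hull_inc\<close>)
    then have "v \<notin> affine hull (?T x)"
      using ugap[of v] v gap_pos by force
    then have "aff_dim (?T x) + 1 = aff_dim (insert v (?T x))"
      by (simp add: aff_dim_insert)
    also have "\<dots> \<le> aff_dim (?T y)"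
      by (rule aff_dim_subset) (use sub vT in blast)
    finally have "aff_dim \<Omega> \<le> aff_dim (?T y) + int n" using Suc.prems(3) by simp
    then obtain r c e where r: "r \<le> n" "y = (\<Sum>j<r. c j *\<^sub>R e j)"
      "\<forall>j<r. c j \<ge> 0 \<and> e j \<in> W \<and> norm (e j) = 1 \<and>
        (\<forall>w\<in>\<Omega>. e j \<bullet> w = e j \<bullet> p \<or> e j \<bullet> w \<le> e j \<bullet> p - \<phi>)"
      using Suc.IH[OF yW y_le] by blast
    have "\<forall>w\<in>\<Omega>. u \<bullet> w = u \<bullet> p \<or> u \<bullet> w \<le> u \<bullet> p - \<phi>"
      using ugap uG by (metis DiffI hull_inc)
    moreover have "t \<ge> 0" using v f_nonneg by simp
    moreover have "x = (\<Sum>j<Suc r. (c(r := t)) j *\<^sub>R (e(r := u)) j)"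
      using r(2) by (simp add: y_def algebra_simps)
    ultimately show ?thesis using r u
      by (intro exI[of _ "Suc r"] exI[of _ "c(r := t)"] exI[of _ "e(r := u)"])
        (auto simp: less_Suc_eq)
  qed
qed

end

end

section \<open>Effect of truncating the coefficients\<close>

text \<open>If every cut normal takes the same value at \<open>w\<close> as at \<open>p\<close>, its
  pairing with \<open>w - \<theta>\<close> is nonnegative and cutting can only lower the sum.
  Otherwise some cut normal alone separates \<open>w\<close> from \<open>p\<close> by
  \<open>L * \<phi>\<close> along \<open>y\<close>.\<close>

lemma truncated_combination_inner:
  fixes u :: "nat \<Rightarrow> 'a::real_inner"
  assumes c: "\<And>j. j < r \<Longrightarrow> c j \<ge> 0" and L: "L \<ge> 0" and "\<phi> > 0"
    and gap: "\<And>j. j < r \<Longrightarrow> u j \<bullet> w = u j \<bullet> p \<or> u j \<bullet> w \<le> u j \<bullet> p - \<phi>"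
    and \<theta>: "\<And>j. j < r \<Longrightarrow> u j \<bullet> \<theta> \<le> u j \<bullet> p"
  defines "x \<equiv> \<Sum>j<r. c j *\<^sub>R u j" and "y \<equiv> \<Sum>j<r. min (c j) L *\<^sub>R u j"
  shows "(w - \<theta>) \<bullet> y \<le> (w - \<theta>) \<bullet> x \<or> (w - \<theta>) \<bullet> y \<le> (p - \<theta>) \<bullet> x - L * \<phi>"
proof -
  have ip: "v \<bullet> x = (\<Sum>j<r. c j * (u j \<bullet> v))" "v \<bullet> y = (\<Sum>j<r. min (c j) L * (u j \<bullet> v))" for v
    by (simp_all add: x_def y_def inner_sum_right inner_commute)
  \<comment> \<open>This trades \<open>y\<close> for \<open>x\<close> on the right of the second
    alternative, so that the error is later compared with the sum at \<open>x\<close>.\<close>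
  have py: "(p - \<theta>) \<bullet> y \<le> (p - \<theta>) \<bullet> x"
    unfolding ip using \<theta> by (intro sum_mono mult_right_mono) (auto simp: inner_diff_right)
  show ?thesis
  proof (cases "\<forall>j<r. c j > L \<longrightarrow> u j \<bullet> w = u j \<bullet> p")
    case True
    have "(w - \<theta>) \<bullet> y \<le> (w - \<theta>) \<bullet> x"
      unfolding ip
    proof (rule sum_mono)
      fix j assume "j \<in> {..<r}"
      then show "min (c j) L * (u j \<bullet> (w - \<theta>)) \<le> c j * (u j \<bullet> (w - \<theta>))"
        using True \<theta>[of j]
        by (cases "c j > L") (auto simp: min_def inner_diff_right intro!: mult_right_mono)
    qed
    then show ?thesis ..
  next
    case False
    then obtain k where k: "k < r" "c k > L" "u k \<bullet> w \<noteq> u k \<bullet> p" by auto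
    have "L * \<phi> \<le> min (c k) L * (u k \<bullet> (p - w))"
      using k gap[of k] L by (auto simp: inner_diff_right intro!: mult_left_mono)
    also have "\<dots> \<le> (\<Sum>j<r. min (c j) L * (u j \<bullet> (p - w)))"
      using k c L gap \<open>\<phi> > 0\<close>
      by (intro member_le_sum) (auto simp: inner_diff_right intro!: mult_nonneg_nonneg, force)
    also have "\<dots> = (p - w) \<bullet> y" by (simp add: ip)
    finally have "(w - \<theta>) \<bullet> y \<le> (p - \<theta>) \<bullet> y - L * \<phi>" by (simp add: inner_diff_left)
    then show ?thesis using py by linarith
  qed
qed

lemma exp_sum_pos:
  fixes q :: "real^'k::finite"
  assumes "\<And>i. q $ i > 0"
  shows "(\<Sum>i\<in>UNIV. q $ i * exp (g i)) > 0"
  using assms by (intro sum_pos) auto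

section \<open>Truncating a near-minimizer\<close>

theorem theorem2p4:
  fixes \<omega> :: "'k::finite \<Rightarrow> real^'n" and q :: "real^'k" and \<theta> :: "real^'n" and \<delta> :: real
  assumes "card (range \<omega>) \<ge> 2"
    and "\<And>i. q $ i > 0"
    and "0 < \<delta>" and "\<delta> < 2 * weight_ratio q"
    and "\<theta> \<in> convex hull (range \<omega>)"
  shows "aff_dim (affine hull (range \<omega>)) \<le> int CARD('n) \<and>
    (\<exists>x\<in>W_space \<omega> \<theta>.
       norm x \<le> real_of_int (aff_dim (affine hull (range \<omega>))) / facet_gap (range \<omega>)
                 * ln (2 * weight_ratio q / \<delta>) \<and>
       F_theta q \<omega> \<theta> x \<le> F_theta_inf q \<omega> \<theta> + \<delta>)"
proof
  show "aff_dim (affine hull (range \<omega>)) \<le> int CARD('n)"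
    using aff_dim_le_DIM[of "affine hull (range \<omega>)"] by simp
next
  let ?\<Omega> = "range \<omega>" and ?W = "W_space \<omega> \<theta>" and ?A = "affine hull (range \<omega>)"
  let ?\<phi> = "facet_gap ?\<Omega>" and ?\<beta> = "weight_ratio q"
  let ?S = "\<lambda>x. \<Sum>i\<in>UNIV. q $ i * exp ((\<omega> i - \<theta>) \<bullet> x)"
  \<comment> \<open>Chosen so that a drop of \<open>L\<close> times the facet gap in the exponent is
    a factor \<open>\<delta> / (2 * ?\<beta>)\<close>; \<open>L\<close> is positive because \<delta>
    is below \<open>2 * ?\<beta>\<close>.\<close>
  define L where "L = ln (2 * ?\<beta> / \<delta>) / ?\<phi>"
  have \<phi>: "?\<phi> > 0" using assms(1) by (intro facet_gap_pos) auto
  have L: "L > 0" unfolding L_def using \<phi> assms(3,4) by (auto intro!: divide_pos_pos ln_gt_zero)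
  have subW: "subspace ?W" by (simp add: W_space_def)
  have "\<theta> \<in> ?A" using assms(5) convex_hull_subset_affine_hull by blast
  \<comment> \<open>Since \<theta> lies in the affine hull, adjoining it to the points changes
    neither the hull nor, contributing only the zero vector, the span.\<close>
  then have "(\<lambda>v. v - \<theta>) ` ?A = span ((\<lambda>v. v - \<theta>) ` insert \<theta> ?\<Omega>)"
    by (subst diffs_affine_hull_span[symmetric]) (auto simp: hull_redundant)
  also have "\<dots> = ?W"
    unfolding W_space_def by (simp add: image_image span_insert_0)
  finally have WA: "?W = (\<lambda>v. v - \<theta>) ` ?A" ..
  have A_iff: "v \<in> ?A \<longleftrightarrow> v - \<theta> \<in> ?W" for v by (auto simp: WA)
  have diff_W: "v - w \<in> ?W" if "v \<in> ?A" "w \<in> ?A" for v w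
    using subspace_diff[OF subW, of "v - \<theta>" "w - \<theta>"] that by (simp add: A_iff)
  have add_W: "v + y \<in> ?A" if "v \<in> ?A" "y \<in> ?W" for v y
    using subspace_add[OF subW, of "v - \<theta>" y] that by (simp add: A_iff algebra_simps)
  have gap: "?\<phi> \<le> infdist w (affine hull F)"
    if "F facet_of convex hull ?\<Omega>" "w \<in> ?\<Omega> - F" for F w
    unfolding facet_gap_def using that
    by (intro Min_le finite_facet_distances) (auto simp: facet_distances_def)

  \<comment> \<open>The infimum need not be attained: half of \<delta> pays for a near-minimizer,
    the other half for the truncation.\<close>
  have "Inf (range (F_theta q \<omega> \<theta>)) < F_theta_inf q \<omega> \<theta> + \<delta> / 2"
    using assms(3) by (simp add: F_theta_inf_def)
  then obtain x0 where x0: "F_theta q \<omega> \<theta> x0 < F_theta_inf q \<omega> \<theta> + \<delta> / 2"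
    using cInf_lessD[of "range (F_theta q \<omega> \<theta>)"] by auto
  \<comment> \<open>Projecting \<open>x0\<close> to \<open>?W\<close> keeps the value, as only
    pairings with \<open>\<omega> i - \<theta>\<close> enter.\<close>
  obtain x z where "x \<in> span ?W" and orth: "\<And>w. w \<in> span ?W \<Longrightarrow> orthogonal z w"
    and x0_eq: "x0 = x + z"
    using orthogonal_subspace_decomp_exists[of ?W x0] by blast
  then have x: "x \<in> ?W" by (simp add: span_eq_iff[THEN iffD2, OF subW])
  have "(\<omega> i - \<theta>) \<bullet> x0 = (\<omega> i - \<theta>) \<bullet> x" for i
    using orth[of "\<omega> i - \<theta>"] unfolding inner_commute[of "\<omega> i - \<theta>"]
    by (simp add: x0_eq inner_add_left orthogonal_def W_space_def span_base)
  then have Fx: "F_theta q \<omega> \<theta> x < F_theta_inf q \<omega> \<theta> + \<delta> / 2"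
    using x0 by (simp add: F_theta_def)

  have "Max (range (\<lambda>i. x \<bullet> \<omega> i)) \<in> range (\<lambda>i. x \<bullet> \<omega> i)" by (intro Max_in) auto
  then obtain i0 where "Max (range (\<lambda>i. x \<bullet> \<omega> i)) = x \<bullet> \<omega> i0" by (rule imageE)
  then have i0: "x \<bullet> \<omega> i \<le> x \<bullet> \<omega> i0" for i
    using Max_ge[of "range (\<lambda>i. x \<bullet> \<omega> i)" "x \<bullet> \<omega> i"] by simp
  let ?p = "\<omega> i0" and ?m = "aff_dim ?A"
  let ?T = "{w \<in> ?\<Omega>. x \<bullet> w = x \<bullet> ?p}"
  \<comment> \<open>A nonempty face has dimension at least 0 rather than -1, so \<open>m\<close>
    normals suffice instead of \<open>m + 1\<close>.\<close>
  have "?T \<noteq> {}" by blast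
  then have T: "aff_dim ?T \<ge> 0"
    using aff_dim_empty[of ?T] aff_dim_geq[of ?T] by linarith
  have m: "?m \<ge> 0"
    using T aff_dim_subset[of "?T" ?\<Omega>] by simp
  obtain r c u where r: "r \<le> nat ?m" and x_eq: "x = (\<Sum>j<r. c j *\<^sub>R u j)"
    and cu: "\<And>j. j < r \<Longrightarrow> c j \<ge> 0 \<and> u j \<in> ?W \<and> norm (u j) = 1 \<and>
      (\<forall>w\<in>?\<Omega>. u j \<bullet> w = u j \<bullet> ?p \<or> u j \<bullet> w \<le> u j \<bullet> ?p - ?\<phi>)"
  proof -
    have dim: "aff_dim ?\<Omega> \<le> aff_dim ?T + int (nat ?m)"
      using T m by simp
    have "\<exists>r c u. r \<le> nat ?m \<and> x = (\<Sum>j<r. c j *\<^sub>R u j) \<and>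
      (\<forall>j<r. c j \<ge> 0 \<and> u j \<in> ?W \<and> norm (u j) = 1 \<and>
        (\<forall>w\<in>?\<Omega>. u j \<bullet> w = u j \<bullet> ?p \<or> u j \<bullet> w \<le> u j \<bullet> ?p - ?\<phi>))"
      by (rule normal_cone_decomposition, simp, rule subW, erule (1) diff_W, erule (1) add_W,
          rule \<phi>, erule (1) gap, simp, rule x, use i0 in force, rule dim)
    then show thesis using that by blast
  qed
  have u\<theta>: "u j \<bullet> \<theta> \<le> u j \<bullet> ?p" if "j < r" for j
  proof -
    have "u j \<bullet> w \<le> u j \<bullet> ?p" if "w \<in> ?\<Omega>" for w
    proof -
      have "u j \<bullet> w = u j \<bullet> ?p \<or> u j \<bullet> w \<le> u j \<bullet> ?p - ?\<phi>"
        using cu[OF \<open>j < r\<close>] that by blast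
      then show ?thesis using \<phi> by linarith
    qed
    then have "convex hull ?\<Omega> \<subseteq> {w. u j \<bullet> w \<le> u j \<bullet> ?p}"
      by (intro hull_minimal convex_halfspace_le) blast
    then show ?thesis using assms(5) by auto
  qed
  define y where "y = (\<Sum>j<r. min (c j) L *\<^sub>R u j)"
  have yW: "y \<in> ?W"
    unfolding y_def using cu subW by (intro subspace_sum subspace_scale) auto
  have "norm y \<le> (\<Sum>j<r. L)"
    unfolding y_def using cu L by (intro sum_norm_le) auto
  also have "\<dots> \<le> real_of_int ?m * L"
    using r m L by (auto intro!: mult_right_mono)
  finally have ny: "norm y \<le> real_of_int ?m / ?\<phi> * ln (2 * ?\<beta> / \<delta>)" by (simp add: L_def)

  let ?qm = "Min (range (($) q))"
  have "?qm \<in> range (($) q)" by (intro Min_in) auto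
  then have qm: "?qm > 0" using assms(2) by auto
  have "2 * ?\<beta> / \<delta> > 0" using assms(3,4) by (intro divide_pos_pos) auto
  then have eL: "exp (- (L * ?\<phi>)) = \<delta> / (2 * ?\<beta>)"
    using \<phi> by (simp add: L_def exp_minus)
  have \<beta>: "(\<Sum>i\<in>UNIV. q $ i) = ?\<beta> * ?qm"
    using assms(2) less_imp_neq[OF qm, symmetric] by (simp add: weight_ratio_def abs_of_pos)
  \<comment> \<open>The term of \<open>?p\<close> alone controls the error: the total weight is
    \<open>?\<beta> * ?qm\<close>, and \<open>?\<beta>\<close> cancels against the factor in
    \<open>eL\<close>.\<close>
  have pS: "?qm * exp ((?p - \<theta>) \<bullet> x) \<le> ?S x"
  proof -
    have "?qm * exp ((?p - \<theta>) \<bullet> x) \<le> q $ i0 * exp ((?p - \<theta>) \<bullet> x)"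
      by (intro mult_right_mono Min_le) auto
    also have "\<dots> \<le> ?S x" by (rule member_le_sum) (auto simp: assms(2) less_imp_le)
    finally show ?thesis .
  qed
  \<comment> \<open>Adding both exponentials covers either alternative of the truncation lemma
    without splitting the index set.\<close>
  have "?S y \<le> (\<Sum>i\<in>UNIV. q $ i * (exp ((\<omega> i - \<theta>) \<bullet> x) + exp ((?p - \<theta>) \<bullet> x - L * ?\<phi>)))"
  proof (intro sum_mono mult_left_mono)
    fix i
    have "(\<omega> i - \<theta>) \<bullet> y \<le> (\<omega> i - \<theta>) \<bullet> x \<or> (\<omega> i - \<theta>) \<bullet> y \<le> (?p - \<theta>) \<bullet> x - L * ?\<phi>"
      unfolding x_eq y_def
      by (rule truncated_combination_inner) (use cu u\<theta> L \<phi> in \<open>simp_all add: less_imp_le\<close>)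
    then show "exp ((\<omega> i - \<theta>) \<bullet> y) \<le> exp ((\<omega> i - \<theta>) \<bullet> x) + exp ((?p - \<theta>) \<bullet> x - L * ?\<phi>)"
      by (metis add_increasing add_increasing2 exp_ge_zero exp_le_cancel_iff)
  qed (simp add: assms(2) less_imp_le)
  also have "\<dots> = ?S x + (\<Sum>i\<in>UNIV. q $ i) * (exp ((?p - \<theta>) \<bullet> x) * exp (- (L * ?\<phi>)))"
    by (simp add: distrib_left sum.distrib sum_distrib_right exp_diff exp_minus divide_inverse mult.assoc)
  also have "\<dots> = ?S x + \<delta> / 2 * (?qm * exp ((?p - \<theta>) \<bullet> x))"
    unfolding \<beta> eL using assms(3,4) by simp
  also have "\<dots> \<le> (1 + \<delta> / 2) * ?S x"
    using pS assms(3) by (simp add: distrib_right mult_left_mono)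
  finally have Sy: "?S y \<le> (1 + \<delta> / 2) * ?S x" .
  have "F_theta q \<omega> \<theta> y \<le> ln ((1 + \<delta> / 2) * ?S x)"
    unfolding F_theta_def by (rule ln_mono) (use Sy exp_sum_pos[OF assms(2)] in auto)
  also have "\<dots> = ln (1 + \<delta> / 2) + F_theta q \<omega> \<theta> x"
    unfolding F_theta_def using assms(3) exp_sum_pos[OF assms(2), of "\<lambda>i. (\<omega> i - \<theta>) \<bullet> x"]
    by (intro ln_mult_pos) auto
  also have "\<dots> \<le> F_theta_inf q \<omega> \<theta> + \<delta>"
    using ln_add_one_self_le_self[of "\<delta> / 2"] Fx assms(3) by simp
  finally show "\<exists>x\<in>?W.
       norm x \<le> real_of_int ?m / ?\<phi> * ln (2 * ?\<beta> / \<delta>) \<and>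
       F_theta q \<omega> \<theta> x \<le> F_theta_inf q \<omega> \<theta> + \<delta>"
    using yW ny by blast
qed

end
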